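(* Every full-dimensional maximal outer-product-free set in $\mathbb{S}^{n_r\times n_r}$ is a convex cone.
   Context: $\mathbb{S}^{n_r\times n_r}$ is the space of real symmetric $n_r\times n_r$ matrices, where $n_r=\binom{n+r}{r}$ for integers $n,r\ge 1$. Let $S_{OP}:=\{X\in\mathbb{S}^{n_r\times n_r}: X=xx^T,\ x\in\mathbb{R}^{n_r}\}$. A set $C\subseteq\mathbb{S}^{n_r\times n_r}$ is outer-product-free if it is closed and convex and $\mathrm{int}(C)\cap S_{OP}=\emptyset$. An outer-product-free set is maximal if it is not strictly contained in any other outer-product-free set. *)

theory Defs
  imports "HOL-Analysis.Analysis"
begin

definition sym_mats :: "(real ^ 'm ^ 'm) set" where
  "sym_mats = {X. transpose X = X}"

definition outer_products :: "(real ^ 'm ^ 'm) set" where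
  "outer_products =
    {X \<in> sym_mats. \<exists>x :: real ^ 'm. X = (columnvector x :: real ^ 1 ^ 'm) ** transpose (columnvector x)}"

text \<open>The ambient space is the space of symmetric matrices, a proper subspace of all square
  matrices as soon as the size is at least 2. Closedness and interior are therefore taken in the
  subspace topology on \<^const>\<open>sym_mats\<close> (so \<^const>\<open>closedin\<close> also yields
  \<^prop>\<open>C \<subseteq> sym_mats\<close>), and full dimension is relative to \<^const>\<open>sym_mats\<close>.\<close>

definition outer_product_free :: "(real ^ 'm ^ 'm) set \<Rightarrow> bool" where
  "outer_product_free C \<longleftrightarrow>
    closedin (top_of_set sym_mats) C \<and> convex C \<and>
    (top_of_set sym_mats interior_of C) \<inter> outer_products = {}"

definition maximal_outer_product_free :: "(real ^ 'm ^ 'm) set \<Rightarrow> bool" where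
  "maximal_outer_product_free C \<longleftrightarrow>
    outer_product_free C \<and> \<not> (\<exists>D. outer_product_free D \<and> C \<subset> D)"

definition full_dimensional :: "(real ^ 'm ^ 'm) set \<Rightarrow> bool" where
  "full_dimensional C \<longleftrightarrow> aff_dim C = int (dim (sym_mats :: (real ^ 'm ^ 'm) set))"

end

theory Submission
  imports Defs
begin

text \<open>Outer products are invariant under multiplication by a nonnegative scalar, because
  \<open>t x x\<^sup>T = y y\<^sup>T\<close> for \<open>y = \<surd>t x\<close>. So if the interior of a convex set \<open>C\<close> contains no outer
  product, then neither does the union of all positive multiples of that interior. When \<open>C\<close> is
  full-dimensional, this union is dense in the closed cone \<open>K\<close> generated by \<open>C\<close>; as both are convex,
  it contains the interior of \<open>K\<close> (lemma \<open>rel_interior_closure_conic_hull_subset\<close>). Hence \<open>K\<close> is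
  outer-product-free, and maximality forces \<open>C = K\<close>.

  Full dimension enters because it makes the affine hull of \<open>C\<close>, and then of \<open>K\<close>, the whole space of
  symmetric matrices. Interiors in that space are then relative interiors, so the theory of
  relative interiors of convex sets applies.\<close>

lemma subspace_sym_mats: "subspace (sym_mats :: (real ^ 'm ^ 'm) set)"
  unfolding sym_mats_def subspace_def by (simp add: transpose_def vec_eq_iff)

lemma outer_products_scaleR:
  fixes X :: "real ^ 'm ^ 'm"
  assumes "X \<in> outer_products" and "0 \<le> t"
  shows "t *\<^sub>R X \<in> outer_products"
proof -
  obtain x where "X \<in> sym_mats"
    and x: "X = (columnvector x :: real ^ 1 ^ 'm) ** transpose (columnvector x)"
    using assms(1) by (auto simp: outer_products_def)
  have "t *\<^sub>R X = (columnvector (sqrt t *\<^sub>R x) :: real ^ 1 ^ 'm)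
      ** transpose (columnvector (sqrt t *\<^sub>R x))"
    using \<open>0 \<le> t\<close>
    by (simp add: x vec_eq_iff matrix_matrix_mult_def columnvector_def transpose_def algebra_simps)
  moreover have "t *\<^sub>R X \<in> sym_mats"
    using subspace_sym_mats \<open>X \<in> sym_mats\<close> by (rule subspace_scale)
  ultimately show ?thesis
    unfolding outer_products_def by blast
qed

lemma interior_of_affine_hull_eq_rel_interior:
  "top_of_set (affine hull S) interior_of S = rel_interior S"
  by (simp add: interior_of_def rel_interior_def)

lemma convex_positive_multiples:
  fixes S :: "'a::real_vector set"
  assumes "convex S"
  shows "convex ((\<lambda>z. fst z *\<^sub>R snd z) ` ({0<..} \<times> S))"
proof -
  have "u *\<^sub>R (s *\<^sub>R x) + v *\<^sub>R (t *\<^sub>R y) \<in> (\<lambda>z. fst z *\<^sub>R snd z) ` ({0<..} \<times> S)"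
    if "x \<in> S" "y \<in> S" "0 < s" "0 < t" "0 \<le> u" "0 \<le> v" "u + v = 1" for u v s t :: real and x y
  proof -
    define w where "w = u * s + v * t"
    have "0 < w"
      using that unfolding w_def
      by (cases "u = 0") (simp_all add: add_pos_nonneg)
    let ?z = "(u * s / w) *\<^sub>R x + (v * t / w) *\<^sub>R y"
    have "?z \<in> S"
    proof (rule convexD[OF assms \<open>x \<in> S\<close> \<open>y \<in> S\<close>])
      show "u * s / w + v * t / w = 1"
        using \<open>0 < w\<close> by (simp add: w_def flip: add_divide_distrib)
    qed (use that \<open>0 < w\<close> in auto)
    moreover have "u *\<^sub>R (s *\<^sub>R x) + v *\<^sub>R (t *\<^sub>R y) = w *\<^sub>R ?z"
      using \<open>0 < w\<close> by (simp add: scaleR_add_right)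
    ultimately show ?thesis
      using \<open>0 < w\<close> by (auto intro!: image_eqI[where x = "(w, ?z)"])
  qed
  then show ?thesis
    by (auto simp: convex_def)
qed

text \<open>The positive multiples of points of the relative interior form a convex set whose closure is
  the closed cone generated by \<open>C\<close>. Convex sets with the same closure have the same relative
  interior, so the relative interior of that cone consists of such multiples.\<close>

lemma rel_interior_closure_conic_hull_subset:
  fixes C :: "'a::euclidean_space set"
  assumes "convex C"
  shows "rel_interior (closure (conic hull C))
    \<subseteq> (\<lambda>z. fst z *\<^sub>R snd z) ` ({0<..} \<times> rel_interior C)"
    (is "_ \<subseteq> ?P")
proof -
  have "conic hull C \<subseteq> closure ?P"
  proof -
    have "closure {0::real<..} = {0..}"
      using convex_closure_interior[of "{0::real..}"] by simp
    then have "{0::real..} \<times> C \<subseteq> closure ({0<..} \<times> rel_interior C)"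
      using closure_subset[of C] assms
      by (auto simp: closure_Times convex_closure_rel_interior)
    \<comment> \<open>Letting the factor tend to 0 is what puts the apex of the cone into the closure.\<close>
    moreover have "(\<lambda>z. fst z *\<^sub>R snd z) ` closure ({0<..} \<times> rel_interior C) \<subseteq> closure ?P"
      by (rule image_closure_subset) (auto intro!: continuous_intros closure_subset)
    ultimately show ?thesis
      unfolding conic_hull_as_image by blast
  qed
  moreover have "?P \<subseteq> conic hull C"
    using rel_interior_subset[of C] unfolding conic_hull_as_image by force
  ultimately have "closure (conic hull C) = closure ?P"
    by (intro antisym closure_minimal closure_mono) auto
  then have "rel_interior (closure (conic hull C)) = rel_interior ?P"
    by (simp add: assms convex_positive_multiples convex_rel_interior convex_rel_interior_closure)
  then show ?thesis
    using rel_interior_subset[of ?P] by simp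
qed

lemma full_dimensional_affine_hull:
  assumes "full_dimensional C" and "C \<subseteq> sym_mats"
  shows "affine hull C = sym_mats"
proof -
  have "aff_dim C = aff_dim (sym_mats :: (real ^ 'a ^ 'a) set)"
    using assms(1) by (simp add: full_dimensional_def aff_dim_subspace subspace_sym_mats)
  then show ?thesis
    using assms(2) by (simp add: aff_dim_eq_full_gen subspace_imp_affine subspace_sym_mats)
qed

lemma outer_product_free_closure_conic_hull:
  assumes free: "outer_product_free C" and full: "full_dimensional C"
  shows "outer_product_free (closure (conic hull C))" (is "outer_product_free ?K")
proof -
  have "C \<subseteq> sym_mats" and "convex C"
    and disj: "(top_of_set sym_mats interior_of C) \<inter> outer_products = {}"
    using free closedin_subset[of "top_of_set sym_mats" C] by (simp_all add: outer_product_free_def)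
  have hull_C: "affine hull C = sym_mats"
    by (rule full_dimensional_affine_hull) fact+
  have "closed (sym_mats :: (real ^ 'a ^ 'a) set)"
    by (simp add: closed_subspace subspace_sym_mats)
  moreover have "conic hull C \<subseteq> sym_mats"
    using \<open>C \<subseteq> sym_mats\<close> by (intro hull_minimal subspace_imp_conic subspace_sym_mats)
  ultimately have "?K \<subseteq> sym_mats"
    by (rule closure_minimal[rotated])
  moreover have "C \<subseteq> ?K"
    using hull_subset closure_subset by (rule subset_trans)
  ultimately have hull_K: "affine hull ?K = sym_mats"
    using hull_mono[of C ?K affine]
    by (intro antisym hull_minimal) (simp_all add: hull_C subspace_imp_affine subspace_sym_mats)
  have "rel_interior ?K \<inter> outer_products = {}"
  proof (rule ccontr)
    assume "rel_interior ?K \<inter> outer_products \<noteq> {}"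
    then obtain Y where "Y \<in> rel_interior ?K" and "Y \<in> outer_products"
      by blast
    then obtain t X where "0 < t" "X \<in> rel_interior C" "t *\<^sub>R X \<in> outer_products"
      using rel_interior_closure_conic_hull_subset[OF \<open>convex C\<close>] by auto
    then have "X \<in> outer_products"
      using outer_products_scaleR[of "t *\<^sub>R X" "1 / t"] by simp
    then show False
      using disj \<open>X \<in> rel_interior C\<close> interior_of_affine_hull_eq_rel_interior[of C] hull_C by auto
  qed
  then show ?thesis
    using \<open>?K \<subseteq> sym_mats\<close> \<open>convex C\<close> interior_of_affine_hull_eq_rel_interior[of ?K] hull_K
    by (simp add: outer_product_free_def closed_subset convex_closure convex_conic_hull)
qed

theorem corollary16:
  fixes n r :: nat and C :: "(real ^ 'm ^ 'm) set"
  assumes "n \<ge> 1" and "r \<ge> 1"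
    and "CARD('m) = (n + r) choose r"
    and "maximal_outer_product_free C"
    and "full_dimensional C"
  shows "convex_cone C"
proof -
  have "outer_product_free C" and max: "\<And>D. outer_product_free D \<Longrightarrow> C \<subseteq> D \<Longrightarrow> C = D"
    using assms(4) by (auto simp: maximal_outer_product_free_def)
  moreover have "C \<subseteq> closure (conic hull C)"
    using hull_subset closure_subset by (rule subset_trans)
  ultimately have "closure (conic hull C) = C"
    using outer_product_free_closure_conic_hull assms(5) by blast
  then have "conic C"
    using conic_closure[OF conic_conic_hull[of C]] by simp
  moreover have "C \<noteq> {}"
    using assms(5) by (auto simp: full_dimensional_def)
  ultimately show ?thesis
    using \<open>outer_product_free C\<close> by (simp add: convex_cone_def outer_product_free_def)
qed

end
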